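(* Let $B^{(n)}$, $Q^{(n)}$, $J$, $N$ be associated with $(\mu,\vec w,\vec n)$ as in the context, and let $\lambda$ be a real point at which the weights are defined. Assume that the limits $\lim_{n\to\infty}J_{n+j,n}=c_j$ exist for $j=0,\dots,N$, with $c_N\neq0$, and put $$\varphi(r)=c_N+c_{N-1}r+\dots+c_1r^{N-1}+(c_0-\lambda)r^N+r^{N+1},\qquad \varphi^*(r)=r^{N+1}\varphi(1/r).$$ Assume moreover the ratio asymptotics $$\lim_{n\to\infty}\frac{B^{(n+1)}(\lambda)}{B^{(n)}(\lambda)}=r_{II}(\lambda)$$ for some root $r_{II}(\lambda)$ of $\varphi$. Let $r_1(\lambda),\dots,r_N(\lambda),r_{II}(\lambda)$ be the roots of $\varphi$ listed with multiplicity (not assumed distinct). Then the linear forms of type I satisfy the order $N$ homogeneous linear recurrence (for $n\ge N$ with $B^{(n)}(\lambda)\ne0$) $$\big(Q^{(n)}(\lambda),\dots,Q^{(n+N-1)}(\lambda)\big)\,M_n\begin{pmatrix}\frac{B^{(n-N)}(\lambda)}{B^{(n)}(\lambda)}\\ \vdots\\ \frac{B^{(n-1)}(\lambda)}{B^{(n)}(\lambda)}\end{pmatrix}=Q^{(n-1)}(\lambda),$$ where $M_n$ is the $N\times N$ upper triangular matrix with entries $(M_n)_{i,j}=J_{n+i-1,\,n-N+j-1}$ for $1\le i\le j\le N$ and $(M_n)_{i,j}=0$ for $i>j$, and the ratios $B^{(n-k)}(\lambda)/B^{(n)}(\lambda)$, $k=1,\dots,N$, are understood as given. The characteristic polynomial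 of this recurrence is $$\Phi^*(r)=-\frac{\varphi^*(r)}{1-r_{II}(\lambda)r}=-(1-r\,r_1(\lambda))\cdots(1-r\,r_N(\lambda)).$$ Thus, if $r_{II}(\lambda)$ is a root of $\varphi$ of multiplicity $1$, then $1/r_{II}(\lambda)$ is not a characteristic root of this order $N$ recurrence, and if $r_{II}(\lambda)$ has multiplicity $m$ ($m>1$), then $1/r_{II}(\lambda)$ is a characteristic root of it with multiplicity $m-1$.
   Context: General setting. $\Delta\subset\mathbb R$ is an interval, $\mu$ is a finite Borel measure of constant sign on $\Delta$ whose support has infinitely many points, $w_1,\dots,w_p$ are weights on $\Delta$ (real integrable functions, each of constant sign, possibly also defined at real points outside $\Delta$), all the moments $\int_\Delta x^k w_a\,d\mu$ being finite, and $\vec n=(n_1,\dots,n_p)$ is a vector of positive integers, $|\vec n|=n_1+\dots+n_p$. Every $i\in\mathbb N_0$ is written uniquely as $i=q(i)|\vec n|+n_1+\dots+n_{a(i)-1}+r(i)$ with $q(i)\in\mathbb N_0$, $a(i)\in\{1,\dots,p\}$, $0\le r(i)<n_{a(i)}$; put $k(i)=q(i)n_{a(i)}+r(i)$ and $\xi^{(i)}(x)=x^{k(i)}w_{a(i)}(x)$. The pair $(\mu,\vec w)$ is assumed perfect; in particular all leading principal minors of the moment matrix $g_{i,j}=\int_\Delta x^i\xi^{(j)}(x)\,d\mu(x)$ are nonzero. Then: - $B^{(l)}$ is the unique monic polynomial of degree $l$ with $\int_\Delta B^{(l)}\xi^{(j)}\,d\mu=0$ for $0\le j<l$ (type II multiple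 orthogonal polynomial); - $Q^{(l)}$ (type I linear form) is the unique real linear combination of the functions $\xi^{(0)},\dots,\xi^{(l)}$ (obtained from the Gauss–Borel factorization of $g$) with $\int_\Delta x^iQ^{(l)}(x)\,d\mu(x)=\delta_{i,l}$ for $0\le i\le l$; - the Jacobi matrix $J=(J_{n,m})_{n,m\in\mathbb N_0}$ is defined by $xB^{(n)}(x)=\sum_m J_{n,m}B^{(m)}(x)$. With $N:=\max_a(|\vec n|-n_a+1)$ one has $J_{n,n+1}=1$ and $J_{n,m}=0$ unless $n-N\le m\le n+1$; moreover $J^\top Q(x)=xQ(x)$ for $Q=(Q^{(0)},Q^{(1)},\dots)^\top$. The characteristic polynomial of a linear recurrence $\sum_{i=0}^{N}\alpha_i(n)y_{n+i}=0$ whose coefficients converge, $\alpha_i(n)\to\alpha_i$ as $n\to\infty$, is $\sum_{i=0}^N\alpha_i r^i$ (here the recurrence is written with $Q^{(n-1)}(\lambda)$ moved to the left-hand side with coefficient $-1$); its roots are the characteristic roots. *)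

theory Defs
  imports
    "HOL-Analysis.Set_Integral"
    "HOL-Computational_Algebra.Polynomial"
    "HOL-Library.Multiset"
    "Jordan_Normal_Form.Matrix"
begin

text \<open>Integration over \<open>\<Delta>\<close> against a finite Borel measure of constant sign. Such a measure is
  \<open>\<sigma> M\<close> with \<open>\<sigma> \<in> {1, -1}\<close> and \<open>M\<close> a (nonnegative) measure of the library.\<close>

definition signed_integral :: "real set \<Rightarrow> real \<Rightarrow> real measure \<Rightarrow> (real \<Rightarrow> real) \<Rightarrow> real" where
  "signed_integral \<Delta> \<sigma> M f = \<sigma> * (LINT x:\<Delta>|M. f x)"

definition measure_support :: "real measure \<Rightarrow> real set" where
  "measure_support M = {x. \<forall>U. open U \<and> x \<in> U \<longrightarrow> emeasure M U > 0}"

definition constant_sign_on :: "real set \<Rightarrow> (real \<Rightarrow> real) \<Rightarrow> bool" where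
  "constant_sign_on A f \<longleftrightarrow> (\<forall>x\<in>A. 0 \<le> f x) \<or> (\<forall>x\<in>A. f x \<le> 0)"

text \<open>A multi-index \<open>\<nu>\<close> (only its entries at \<open>1, \<dots>, p\<close> matter; zero entries are allowed) is normal
  if every nontrivial solution of the type II orthogonality conditions has the maximal
  degree \<open>|\<nu>|\<close>; the system is perfect if all multi-indices are normal. Here \<open>I\<close> is
  integration against the measure.\<close>

definition normal_index ::
  "((real \<Rightarrow> real) \<Rightarrow> real) \<Rightarrow> nat \<Rightarrow> (nat \<Rightarrow> real \<Rightarrow> real) \<Rightarrow> (nat \<Rightarrow> nat) \<Rightarrow> bool" where
  "normal_index I p w \<nu> \<longleftrightarrow>
     (\<forall>P :: real poly. P \<noteq> 0 \<and> degree P \<le> (\<Sum>a=1..p. \<nu> a) \<and>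
        (\<forall>a\<in>{1..p}. \<forall>k<\<nu> a. I (\<lambda>x. poly P x * (x ^ k * w a x)) = 0)
        \<longrightarrow> degree P = (\<Sum>a=1..p. \<nu> a))"

definition perfect_system ::
  "((real \<Rightarrow> real) \<Rightarrow> real) \<Rightarrow> nat \<Rightarrow> (nat \<Rightarrow> real \<Rightarrow> real) \<Rightarrow> bool" where
  "perfect_system I p w \<longleftrightarrow> (\<forall>\<nu>. normal_index I p w \<nu>)"

definition mop_setting ::
  "real set \<Rightarrow> real \<Rightarrow> real measure \<Rightarrow> nat \<Rightarrow> (nat \<Rightarrow> nat) \<Rightarrow> (nat \<Rightarrow> real \<Rightarrow> real) \<Rightarrow> bool" where
  "mop_setting \<Delta> \<sigma> M p nv w \<longleftrightarrow>
     is_interval \<Delta> \<and> \<sigma> \<in> {1, -1} \<and>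
     finite_measure M \<and> sets M = sets borel \<and> emeasure M (- \<Delta>) = 0 \<and>
     infinite (measure_support M) \<and>
     1 \<le> p \<and> (\<forall>a\<in>{1..p}. 1 \<le> nv a) \<and>
     (\<forall>a\<in>{1..p}. set_integrable M \<Delta> (w a) \<and> constant_sign_on \<Delta> (w a)) \<and>
     (\<forall>a\<in>{1..p}. \<forall>k::nat. set_integrable M \<Delta> (\<lambda>x. x ^ k * w a x)) \<and>
     perfect_system (signed_integral \<Delta> \<sigma> M) p w"

definition abs_index :: "nat \<Rightarrow> (nat \<Rightarrow> nat) \<Rightarrow> nat" where
  "abs_index p nv = (\<Sum>a=1..p. nv a)"

text \<open>The triple \<open>(q(i), a(i), r(i))\<close>.\<close>

definition index_decomp :: "nat \<Rightarrow> (nat \<Rightarrow> nat) \<Rightarrow> nat \<Rightarrow> nat \<times> nat \<times> nat" where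
  "index_decomp p nv i =
     (THE (q, a, r). a \<in> {1..p} \<and> r < nv a \<and>
        i = q * abs_index p nv + (\<Sum>b=1..<a. nv b) + r)"

definition xi :: "nat \<Rightarrow> (nat \<Rightarrow> nat) \<Rightarrow> (nat \<Rightarrow> real \<Rightarrow> real) \<Rightarrow> nat \<Rightarrow> real \<Rightarrow> real" where
  "xi p nv w i x = (case index_decomp p nv i of (q, a, r) \<Rightarrow> x ^ (q * nv a + r) * w a x)"

definition type_II_poly ::
  "((real \<Rightarrow> real) \<Rightarrow> real) \<Rightarrow> (nat \<Rightarrow> real \<Rightarrow> real) \<Rightarrow> nat \<Rightarrow> real poly" where
  "type_II_poly I \<xi> l =
     (THE P. degree P = l \<and> lead_coeff P = 1 \<and> (\<forall>j<l. I (\<lambda>x. poly P x * \<xi> j x) = 0))"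

text \<open>The coefficients of the type I form are singled out, rather than the form as a function on
  \<open>\<Delta>\<close>, because the form is also evaluated at points outside \<open>\<Delta>\<close>.\<close>

definition type_I_coeff ::
  "((real \<Rightarrow> real) \<Rightarrow> real) \<Rightarrow> (nat \<Rightarrow> real \<Rightarrow> real) \<Rightarrow> nat \<Rightarrow> nat \<Rightarrow> real" where
  "type_I_coeff I \<xi> l =
     (THE c. (\<forall>j>l. c j = 0) \<and>
        (\<forall>i\<le>l. I (\<lambda>x. x ^ i * (\<Sum>j\<le>l. c j * \<xi> j x)) = (if i = l then 1 else 0)))"

definition type_I_form ::
  "((real \<Rightarrow> real) \<Rightarrow> real) \<Rightarrow> (nat \<Rightarrow> real \<Rightarrow> real) \<Rightarrow> nat \<Rightarrow> real \<Rightarrow> real" where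
  "type_I_form I \<xi> l x = (\<Sum>j\<le>l. type_I_coeff I \<xi> l j * \<xi> j x)"

text \<open>Row \<open>n\<close> of the Jacobi matrix: the coordinates of \<open>x B\<^sub>n\<close> in the basis \<open>(B\<^sub>m)\<close>.\<close>

definition jacobi_matrix :: "(nat \<Rightarrow> real poly) \<Rightarrow> nat \<Rightarrow> nat \<Rightarrow> real" where
  "jacobi_matrix B n =
     (THE c. finite {m. c m \<noteq> 0} \<and>
        [:0, 1:] * B n = (\<Sum>m | c m \<noteq> 0. Polynomial.smult (c m) (B m)))"

definition band_width :: "nat \<Rightarrow> (nat \<Rightarrow> nat) \<Rightarrow> nat" where
  "band_width p nv = Max ((\<lambda>a. abs_index p nv - nv a + 1) ` {1..p})"

definition phi :: "nat \<Rightarrow> (nat \<Rightarrow> real) \<Rightarrow> real \<Rightarrow> real poly" where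
  "phi N c lam =
     (\<Sum>j=1..N. monom (c j) (N - j)) + monom (c 0 - lam) N + monom 1 (N + 1)"

definition phi_star :: "nat \<Rightarrow> (nat \<Rightarrow> real) \<Rightarrow> real \<Rightarrow> real poly" where
  "phi_star N c lam = reflect_poly (phi N c lam)"

lemma degree_phi: "degree (phi N c lam) = N + 1"
proof -
  have 1: "degree ((\<Sum>j=1..N. monom (c j) (N - j)) + monom (c 0 - lam) N) \<le> N"
    by (intro degree_add_le degree_sum_le) (auto intro: order.trans[OF degree_monom_le])
  show ?thesis
    unfolding phi_def
    by (subst degree_add_eq_right) (use 1 in \<open>auto simp: degree_monom_eq\<close>)
qed

lemma poly_phi_star:
  assumes "r \<noteq> 0"
  shows "poly (phi_star N c lam) r = r ^ (N + 1) * poly (phi N c lam) (1 / r)"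
  using assms unfolding phi_star_def
  by (simp add: poly_reflect_poly_nz degree_phi inverse_eq_divide)

text \<open>The matrix \<open>M\<^sub>n\<close> and the column of ratios, with rows and columns numbered from \<open>0\<close>. Both are
  only used for \<open>n \<ge> N\<close>.\<close>

definition rec_matrix :: "nat \<Rightarrow> (nat \<Rightarrow> nat \<Rightarrow> real) \<Rightarrow> nat \<Rightarrow> real mat" where
  "rec_matrix N J n =
     Matrix.mat N N (\<lambda>(i, j). if i \<le> j then J (n + i) (n - N + j) else 0)"

definition ratio_vec :: "nat \<Rightarrow> (nat \<Rightarrow> real poly) \<Rightarrow> real \<Rightarrow> nat \<Rightarrow> real vec" where
  "ratio_vec N B lam n =
     Matrix.vec N (\<lambda>j. poly (B (n - N + j)) lam / poly (B n) lam)"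

text \<open>The coefficient of \<open>Q\<^sub>n\<^sub>-\<^sub>1\<^sub>+\<^sub>i\<close> (\<open>0 \<le> i \<le> N\<close>) in the recurrence, once \<open>Q\<^sub>n\<^sub>-\<^sub>1\<close> has been moved to the
  left-hand side.\<close>

definition rec_coeff ::
  "nat \<Rightarrow> (nat \<Rightarrow> nat \<Rightarrow> real) \<Rightarrow> (nat \<Rightarrow> real poly) \<Rightarrow> real \<Rightarrow> nat \<Rightarrow> nat \<Rightarrow> real" where
  "rec_coeff N J B lam n i =
     (if i = 0 then -1
      else vec_index (rec_matrix N J n *\<^sub>v ratio_vec N B lam n) (i - 1))"

text \<open>Characteristic polynomial of an order \<open>N\<close> linear recurrence with coefficients \<open>\<alpha> n i\<close>,
  meaningful when \<open>\<alpha> n i\<close> converges as \<open>n \<rightarrow> \<infinity>\<close> for all \<open>i \<le> N\<close>.\<close>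

definition recurrence_char_poly :: "nat \<Rightarrow> (nat \<Rightarrow> nat \<Rightarrow> real) \<Rightarrow> real poly" where
  "recurrence_char_poly N \<alpha> = (\<Sum>i\<le>N. monom (lim (\<lambda>n. \<alpha> n i)) i)"

end

theory Submission
  imports Defs "HOL-Computational_Algebra.Fundamental_Theorem_Algebra"
begin

text \<open>Biorthogonality of the \<open>B n\<close> and the \<open>Q n\<close> gives \<open>\<lambda> Q n(\<lambda>) = \<Sum>m. J m n Q m(\<lambda>)\<close>, also at points
  \<open>\<lambda>\<close> outside \<open>\<Delta>\<close> because it is an identity between the coefficients with respect to the
  \<open>\<xi>\<close>. Together with \<open>\<lambda> B n(\<lambda>) = \<Sum>m. J n m B m(\<lambda>)\<close>, the Christoffel--Darboux argument on the diagonal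
  shows that \<open>Q (n - 1) B n\<close> at \<open>\<lambda>\<close> is the sum of \<open>J m k Q m B k\<close> over \<open>k < n \<le> m\<close>; dividing by \<open>B n\<close>
  gives the recurrence of order \<open>N\<close>. Its coefficients converge to \<open>\<Sum>k\<ge>1. c (i - 1 + k) / r_II ^ k\<close>,
  and these partial sums are the coefficients produced by dividing \<open>\<phi>_star\<close> by
  \<open>1 - r_II x\<close>, so that \<open>\<Phi>_star\<close> is minus the quotient. Roots of \<open>\<phi>\<close> and of \<open>\<phi>_star\<close> correspond under
  inversion, with multiplicities.\<close>

section \<open>Biorthogonal systems of a nondegenerate form\<close>

text \<open>\<open>\<beta> P j\<close> models the integral of \<open>P\<close> times
  \<open>\<xi> j\<close>, so that the algebra is independent of measure and weights.
  \<open>nondegenerate\<close> is normality along the step line.\<close>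

locale orthogonality_form =
  fixes \<beta> :: "real poly \<Rightarrow> nat \<Rightarrow> real"
  assumes beta_add: "\<beta> (P + R) j = \<beta> P j + \<beta> R j"
    and beta_smult: "\<beta> (Polynomial.smult a P) j = a * \<beta> P j"
    and nondegenerate: "P \<noteq> 0 \<Longrightarrow> degree P \<le> l \<Longrightarrow> (\<And>j. j < l \<Longrightarrow> \<beta> P j = 0) \<Longrightarrow> degree P = l"
begin

lemma beta_diff: "\<beta> (P - R) j = \<beta> P j - \<beta> R j"
  using beta_add[of P "Polynomial.smult (- 1) R" j] beta_smult[of "- 1" R j] by simp

lemma beta_0: "\<beta> 0 j = 0"
  using beta_smult[of 0 0 j] by simp

lemma beta_sum: "\<beta> (sum f A) j = (\<Sum>x\<in>A. \<beta> (f x) j)"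
  by (induction A rule: infinite_finite_induct) (auto simp: beta_0 beta_add)

section \<open>Existence and uniqueness of the monic type II polynomials\<close>

definition is_typeII :: "nat \<Rightarrow> real poly \<Rightarrow> bool" where
  "is_typeII l P \<longleftrightarrow> degree P = l \<and> lead_coeff P = 1 \<and> (\<forall>j<l. \<beta> P j = 0)"

text \<open>The difference of two monic candidates has coefficient zero at \<open>l\<close>, whereas
  \<open>nondegenerate\<close> would give it degree exactly \<open>l\<close>.\<close>

lemma is_typeII_unique:
  assumes "is_typeII l P" "is_typeII l R"
  shows "P = R"
proof (rule ccontr)
  assume "P \<noteq> R"
  then have nz: "P - R \<noteq> 0" by simp
  have "degree (P - R) = l"
    by (rule nondegenerate[OF nz])
      (use assms in \<open>auto simp: is_typeII_def beta_diff intro!: degree_diff_le\<close>)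
  moreover have "Polynomial.coeff P l = 1" "Polynomial.coeff R l = 1"
    using assms by (auto simp: is_typeII_def)
  then have "Polynomial.coeff (P - R) l = 0" by simp
  ultimately show False
    using nz by (metis leading_coeff_0_iff)
qed

text \<open>If the value at \<open>l\<close> vanished too, the conditions below \<open>Suc l\<close>
  would hold and force degree \<open>Suc l\<close>. These values are the pivots in the later
  eliminations.\<close>

lemma is_typeII_pivot_nonzero:
  assumes "is_typeII l P"
  shows "\<beta> P l \<noteq> 0"
proof
  assume "\<beta> P l = 0"
  then have "degree P = Suc l"
    using assms by (intro nondegenerate) (auto simp: is_typeII_def less_Suc_eq)
  then show False
    using assms by (simp add: is_typeII_def)
qed

text \<open>Gram--Schmidt: the condition at \<open>k\<close> is enforced by subtracting a multiple of the polynomial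
  of degree \<open>k\<close>, which leaves the conditions below \<open>k\<close> intact.\<close>

lemma is_typeII_exists: "\<exists>P. is_typeII l P"
proof (induction l rule: less_induct)
  case (less l)
  have "k \<le> l \<Longrightarrow> \<exists>P. degree P = l \<and> lead_coeff P = 1 \<and> (\<forall>j<k. \<beta> P j = 0)" for k
  proof (induction k)
    case 0
    have "degree (monom (1::real) l) = l"
      by (simp add: degree_monom_eq)
    then show ?case
      by (intro exI[of _ "monom 1 l"]) simp
  next
    case (Suc k)
    then obtain P where P: "degree P = l" "lead_coeff P = 1" "\<forall>j<k. \<beta> P j = 0"
      by auto
    obtain R where R: "is_typeII k R"
      using less.IH[of k] Suc.prems by auto
    define P' where "P' = P - Polynomial.smult (\<beta> P k / \<beta> R k) R"
    have deg_R: "degree R = k" and R_zero: "\<And>j. j < k \<Longrightarrow> \<beta> R j = 0" and R_k: "\<beta> R k \<noteq> 0"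
      using R is_typeII_pivot_nonzero[OF R] by (auto simp: is_typeII_def)
    have "k < l" using Suc.prems by simp
    then have c: "Polynomial.coeff P' l = 1"
      using P deg_R by (simp add: P'_def coeff_eq_0)
    have "degree P' \<le> l"
      unfolding P'_def using P deg_R \<open>k < l\<close>
      by (intro degree_diff_le) (auto intro: order.trans[OF degree_smult_le])
    then have "degree P' = l"
      using c by (metis le_antisym le_degree zero_neq_one)
    moreover have "\<forall>j<Suc k. \<beta> P' j = 0"
      using P R_zero R_k by (auto simp: P'_def beta_diff beta_smult less_Suc_eq)
    ultimately show ?case
      using c by (intro exI[of _ P']) simp
  qed
  from this[of l] show ?case
    by (auto simp: is_typeII_def)
qed

definition BII :: "nat \<Rightarrow> real poly" where
  "BII l = (THE P. is_typeII l P)"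

lemma is_typeII_BII: "is_typeII l (BII l)"
  unfolding BII_def
  by (rule theI'[OF ex_ex1I[OF is_typeII_exists is_typeII_unique]])

lemma degree_BII [simp]: "degree (BII l) = l"
  and coeff_BII [simp]: "Polynomial.coeff (BII l) l = 1"
  and beta_BII_eq_0: "j < l \<Longrightarrow> \<beta> (BII l) j = 0"
  using is_typeII_BII[of l] by (auto simp: is_typeII_def)

lemma beta_BII_nonzero: "\<beta> (BII l) l \<noteq> 0"
  by (rule is_typeII_pivot_nonzero[OF is_typeII_BII])

lemma BII_expansion:
  assumes "degree P \<le> K"
  shows "\<exists>d. P = (\<Sum>m\<le>K. Polynomial.smult (d m) (BII m))"
  using assms
proof (induction K arbitrary: P)
  case 0
  have "degree (BII 0) = 0" "Polynomial.coeff (BII 0) 0 = 1"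
    by (rule degree_BII coeff_BII)+
  then have "BII 0 = 1"
    using degree_0_id[of "BII 0"] by (simp add: one_pCons)
  moreover from 0 have "P = [:Polynomial.coeff P 0:]"
    using degree_0_id[of P] by simp
  ultimately show ?case
    by (intro exI[of _ "\<lambda>_. Polynomial.coeff P 0"]) simp
next
  case (Suc K)
  define a where "a = Polynomial.coeff P (Suc K)"
  define R where "R = P - Polynomial.smult a (BII (Suc K))"
  have "degree R \<le> Suc K"
    unfolding R_def using Suc.prems
    by (intro degree_diff_le) (auto intro: order.trans[OF degree_smult_le])
  moreover have "Polynomial.coeff R (Suc K) = 0"
    by (simp add: R_def a_def)
  ultimately have "degree R \<le> K"
    by (metis coeff_0_degree_minus_1 diff_Suc_1 le_SucE)
  then obtain d where d: "R = (\<Sum>m\<le>K. Polynomial.smult (d m) (BII m))"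
    using Suc.IH by blast
  have "P = R + Polynomial.smult a (BII (Suc K))"
    by (simp add: R_def)
  also have "\<dots> = (\<Sum>m\<le>Suc K. Polynomial.smult ((d(Suc K := a)) m) (BII m))"
    unfolding d by simp
  finally show ?case by blast
qed

text \<open>The functional \<open>P \<mapsto> \<integral> P F d\<mu>\<close> for the linear form \<open>F = \<Sum>j\<le>K. c j * \<xi> j\<close>.\<close>

definition pair_form :: "nat \<Rightarrow> (nat \<Rightarrow> real) \<Rightarrow> real poly \<Rightarrow> real" where
  "pair_form K c P = (\<Sum>j\<le>K. c j * \<beta> P j)"

lemma pair_form_sum: "pair_form K c (sum f A) = (\<Sum>x\<in>A. pair_form K c (f x))"
  unfolding pair_form_def beta_sum sum_distrib_left by (rule sum.swap)

lemma pair_form_smult: "pair_form K c (Polynomial.smult a P) = a * pair_form K c P"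
  unfolding pair_form_def beta_smult sum_distrib_left by (intro sum.cong) auto

text \<open>The matrix \<open>\<beta> (BII i) j\<close> is upper triangular with nonzero diagonal:
  \<open>BII (Suc K)\<close> sees only the top coefficient, which therefore vanishes, and induction
  handles the rest.\<close>

lemma pair_form_zero_coeffs:
  assumes "\<And>i. i \<le> K \<Longrightarrow> pair_form K c (BII i) = 0" "j \<le> K"
  shows "c j = 0"
  using assms
proof (induction K arbitrary: j)
  case 0
  then show ?case
    using beta_BII_nonzero[of 0] by (simp add: pair_form_def)
next
  case (Suc K)
  have "pair_form (Suc K) c (BII (Suc K)) = c (Suc K) * \<beta> (BII (Suc K)) (Suc K)"
    by (simp add: pair_form_def beta_BII_eq_0)
  then have top: "c (Suc K) = 0"
    using Suc.prems(1)[of "Suc K"] beta_BII_nonzero[of "Suc K"] by simp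
  then have "pair_form K c (BII i) = 0" if "i \<le> K" for i
    using Suc.prems(1)[of i] that by (simp add: pair_form_def)
  then show ?case
    using Suc.IH Suc.prems(2) top by (cases "j = Suc K") auto
qed

section \<open>Type I linear forms and their biorthogonality with the type II polynomials\<close>

definition is_typeI :: "nat \<Rightarrow> (nat \<Rightarrow> real) \<Rightarrow> bool" where
  "is_typeI l c \<longleftrightarrow> (\<forall>j>l. c j = 0) \<and> (\<forall>i\<le>l. pair_form l c (monom 1 i) = (if i = l then 1 else 0))"

text \<open>Monomials and the \<open>BII i\<close> are both bases in degree at most
  \<open>l\<close>; in either basis the condition says that the pairing returns the coefficient at
  \<open>l\<close>. The second basis makes the system for \<open>c\<close> triangular.\<close>

lemma is_typeI_iff:
  "is_typeI l c \<longleftrightarrow> (\<forall>j>l. c j = 0) \<and> (\<forall>i\<le>l. pair_form l c (BII i) = (if i = l then 1 else 0))"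
proof -
  have "(\<forall>i\<le>l. pair_form l c (monom 1 i) = (if i = l then 1 else 0)) \<longleftrightarrow>
        (\<forall>P. degree P \<le> l \<longrightarrow> pair_form l c P = Polynomial.coeff P l)" (is "?L \<longleftrightarrow> ?A")
  proof
    assume L: ?L
    show ?A
    proof (intro allI impI)
      fix P :: "real poly" assume "degree P \<le> l"
      then have "P = (\<Sum>i\<le>l. Polynomial.smult (Polynomial.coeff P i) (monom 1 i))"
        using poly_as_sum_of_monoms'[of P l] by (simp add: smult_monom)
      then have "pair_form l c P =
          pair_form l c (\<Sum>i\<le>l. Polynomial.smult (Polynomial.coeff P i) (monom 1 i))"
        by (rule arg_cong)
      also have "\<dots> = (\<Sum>i\<le>l. Polynomial.coeff P i * pair_form l c (monom 1 i))"
        by (simp only: pair_form_sum pair_form_smult)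
      also have "\<dots> = (\<Sum>i\<le>l. if i = l then Polynomial.coeff P l else 0)"
        using L by (intro sum.cong) auto
      finally show "pair_form l c P = Polynomial.coeff P l" by simp
    qed
  qed (auto simp: degree_monom_eq)
  also have "?A \<longleftrightarrow> (\<forall>i\<le>l. pair_form l c (BII i) = (if i = l then 1 else 0))" (is "_ \<longleftrightarrow> ?R")
  proof
    assume R: ?R
    show ?A
    proof (intro allI impI)
      fix P :: "real poly" assume "degree P \<le> l"
      then obtain d where d: "P = (\<Sum>m\<le>l. Polynomial.smult (d m) (BII m))"
        using BII_expansion by blast
      have "pair_form l c P = (\<Sum>m\<le>l. d m * pair_form l c (BII m))"
        unfolding d by (simp add: pair_form_sum pair_form_smult)
      also have "\<dots> = (\<Sum>m\<le>l. if m = l then d l else 0)"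
        using R by (intro sum.cong) auto
      also have "\<dots> = d l" by simp
      also have "d l = (\<Sum>m\<le>l. d m * Polynomial.coeff (BII m) l)"
      proof -
        have "(\<Sum>m\<le>l. d m * Polynomial.coeff (BII m) l) = (\<Sum>m\<le>l. if m = l then d l else 0)"
          by (intro sum.cong) (auto simp: coeff_eq_0)
        then show ?thesis by simp
      qed
      also have "\<dots> = Polynomial.coeff P l"
        unfolding d by (simp add: coeff_sum)
      finally show "pair_form l c P = Polynomial.coeff P l" .
    qed
  qed (auto simp: coeff_eq_0)
  finally show ?thesis
    by (auto simp: is_typeI_def)
qed

lemma is_typeI_unique:
  assumes "is_typeI l c" "is_typeI l d"
  shows "c = d"
proof
  fix j
  have "pair_form l (\<lambda>j. c j - d j) (BII i) = 0" if "i \<le> l" for i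
  proof -
    have "pair_form l (\<lambda>j. c j - d j) (BII i) = pair_form l c (BII i) - pair_form l d (BII i)"
      by (simp add: pair_form_def left_diff_distrib sum_subtractf)
    then show ?thesis
      using assms that by (simp add: is_typeI_iff)
  qed
  then have "c j - d j = 0" if "j \<le> l"
    using pair_form_zero_coeffs[of l "\<lambda>j. c j - d j" j] that by blast
  then show "c j = d j"
    using assms by (cases "j \<le> l") (auto simp: is_typeI_def)
qed

text \<open>Back substitution: the coefficient at \<open>t\<close> is adjusted once the pairings
  with \<open>BII i\<close> for \<open>i > t\<close> are right, and these stay unaffected because
  \<open>\<beta> (BII i) t = 0\<close>.\<close>

lemma is_typeI_exists: "\<exists>c. is_typeI l c"
proof -
  have "k \<le> l \<Longrightarrow> \<exists>c. (\<forall>j>l. c j = 0) \<and>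
          (\<forall>i. l - k \<le> i \<and> i \<le> l \<longrightarrow> pair_form l c (BII i) = (if i = l then 1 else 0))" for k
  proof (induction k)
    case 0
    have "pair_form l (\<lambda>j. if j = l then 1 / \<beta> (BII l) l else 0) (BII l) = 1"
      using beta_BII_nonzero[of l]
      by (simp add: pair_form_def if_distrib[where f = "\<lambda>x. x * _"] cong: if_cong)
    then show ?case
      by (intro exI[of _ "\<lambda>j. if j = l then 1 / \<beta> (BII l) l else 0"]) auto
  next
    case (Suc k)
    then obtain c where c: "\<forall>j>l. c j = 0"
      "\<And>i. l - k \<le> i \<Longrightarrow> i \<le> l \<Longrightarrow> pair_form l c (BII i) = (if i = l then 1 else 0)"
      by auto
    define t where "t = l - Suc k"
    have t: "t < l" "l - k = Suc t"
      using Suc.prems by (auto simp: t_def)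
    define d where "d = (\<lambda>j. c j - (if j = t then pair_form l c (BII t) / \<beta> (BII t) t else 0))"
    have d: "pair_form l d (BII i) =
        pair_form l c (BII i) - pair_form l c (BII t) / \<beta> (BII t) t * \<beta> (BII i) t" for i
      using t by (simp add: pair_form_def d_def left_diff_distrib sum_subtractf
          if_distrib[where f = "\<lambda>x. x * _"] cong: if_cong)
    have "pair_form l d (BII i) = (if i = l then 1 else 0)" if "l - Suc k \<le> i" "i \<le> l" for i
    proof (cases "i = t")
      case True
      then show ?thesis
        using t beta_BII_nonzero[of t] by (simp add: d)
    next
      case False
      then have "t < i" using that by (simp add: t_def)
      then show ?thesis
        using c(2)[of i] that t by (simp add: d beta_BII_eq_0)
    qed
    moreover have "\<forall>j>l. d j = 0"
      using c t by (auto simp: d_def)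
    ultimately show ?case by blast
  qed
  from this[of l] show ?thesis
    by (auto simp: is_typeI_iff)
qed

definition CI :: "nat \<Rightarrow> nat \<Rightarrow> real" where
  "CI l = (THE c. is_typeI l c)"

lemma is_typeI_CI: "is_typeI l (CI l)"
  unfolding CI_def
  by (rule theI'[OF ex_ex1I[OF is_typeI_exists is_typeI_unique]])

lemma CI_eq_0: "l < j \<Longrightarrow> CI l j = 0"
  using is_typeI_CI by (auto simp: is_typeI_def)

lemma pair_form_CI:
  assumes "l \<le> K"
  shows "pair_form K (CI l) P = pair_form l (CI l) P"
  unfolding pair_form_def
  by (rule sum.mono_neutral_right) (use assms CI_eq_0 in auto)

text \<open>The type I conditions cover \<open>i \<le> l\<close>; for larger \<open>i\<close> every
  term vanishes by orthogonality of \<open>BII i\<close>.\<close>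

lemma biorthogonal: "pair_form l (CI l) (BII i) = (if i = l then 1 else 0)"
proof (cases "i \<le> l")
  case True
  then show ?thesis
    using is_typeI_CI[of l] by (simp add: is_typeI_iff)
next
  case False
  then show ?thesis
    by (auto simp: pair_form_def beta_BII_eq_0)
qed

lemma BII_coordinate:
  assumes "finite A"
  shows "pair_form m (CI m) (\<Sum>k\<in>A. Polynomial.smult (d k) (BII k)) = (if m \<in> A then d m else 0)"
  using assms
  by (simp add: pair_form_sum pair_form_smult biorthogonal if_distrib[where f = "\<lambda>x. _ * x"]
      cong: if_cong)

text \<open>This writes \<open>\<xi> i\<close> as a combination of type I forms, at the level of
  coefficients. The difference of both sides pairs to zero with every \<open>BII t\<close>, so
  \<open>pair_form_zero_coeffs\<close> applies.\<close>

lemma CI_dual_expansion: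
  assumes "i \<le> K"
  shows "(\<Sum>m\<le>K. \<beta> (BII m) i * CI m j) = (if j = i then 1 else 0)"
proof (cases "j \<le> K")
  case True
  define d where "d = (\<lambda>j. (\<Sum>m\<le>K. \<beta> (BII m) i * CI m j) - (if j = i then 1 else 0))"
  have "pair_form K d (BII t) = 0" if "t \<le> K" for t
  proof -
    have "pair_form K d (BII t) =
        (\<Sum>j\<le>K. \<Sum>m\<le>K. \<beta> (BII m) i * (CI m j * \<beta> (BII t) j)) - \<beta> (BII t) i"
      using assms
      by (simp add: pair_form_def d_def left_diff_distrib sum_subtractf sum_distrib_right
          mult.assoc if_distrib[where f = "\<lambda>x. x * _"] cong: if_cong)
    also have "(\<Sum>j\<le>K. \<Sum>m\<le>K. \<beta> (BII m) i * (CI m j * \<beta> (BII t) j)) =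
        (\<Sum>m\<le>K. \<beta> (BII m) i * pair_form K (CI m) (BII t))"
      by (subst sum.swap) (simp add: pair_form_def sum_distrib_left)
    also have "(\<Sum>m\<le>K. \<beta> (BII m) i * pair_form K (CI m) (BII t)) =
        (\<Sum>m\<le>K. if t = m then \<beta> (BII t) i else 0)"
      by (intro sum.cong) (auto simp: pair_form_CI biorthogonal)
    finally show ?thesis
      using that by simp
  qed
  then have "d j = 0"
    using pair_form_zero_coeffs True by blast
  then show ?thesis by (simp add: d_def)
next
  case False
  then show ?thesis
    using assms by (auto intro!: sum.neutral simp: CI_eq_0)
qed

section \<open>The Jacobi matrix as the coordinates of multiplication by \<open>x\<close>\<close>

definition Jac :: "nat \<Rightarrow> nat \<Rightarrow> real" where
  "Jac n m = pair_form m (CI m) ([:0, 1:] * BII n)"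

text \<open>By biorthogonality, pairing with \<open>CI m\<close> is the coordinate functional of
  \<open>BII m\<close>. Comparing leading coefficients gives the superdiagonal.\<close>

lemma x_BII_expansion:
  "[:0, 1:] * BII n = (\<Sum>m\<le>Suc n. Polynomial.smult (Jac n m) (BII m))"
  and Jac_upper: "Suc n < m \<Longrightarrow> Jac n m = 0"
  and Jac_super: "Jac n (Suc n) = 1"
proof -
  have deg: "degree ([:0, 1:] * BII n) \<le> Suc n"
    by (simp add: degree_pCons_le)
  then obtain d where d: "[:0, 1:] * BII n = (\<Sum>m\<le>Suc n. Polynomial.smult (d m) (BII m))"
    using BII_expansion by blast
  have J: "Jac n m = (if m \<le> Suc n then d m else 0)" for m
    unfolding Jac_def d by (subst BII_coordinate) auto
  then show *: "[:0, 1:] * BII n = (\<Sum>m\<le>Suc n. Polynomial.smult (Jac n m) (BII m))"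
    unfolding d by (intro sum.cong) auto
  show "Suc n < m \<Longrightarrow> Jac n m = 0"
    by (simp add: J)
  have "(1::real) = Polynomial.coeff ([:0, 1:] * BII n) (Suc n)"
    by simp
  also have "\<dots> = (\<Sum>m\<le>Suc n. Jac n m * Polynomial.coeff (BII m) (Suc n))"
    by (subst *) (simp only: coeff_sum coeff_smult)
  also have "\<dots> = (\<Sum>m\<le>Suc n. if m = Suc n then Jac n m else 0)"
    by (intro sum.cong) (auto simp: coeff_eq_0)
  finally show "Jac n (Suc n) = 1" by simp
qed

text \<open>Any finitely supported expansion has its coefficients read off by
  \<open>BII_coordinate\<close>, which is the uniqueness demanded by the definite
  description.\<close>

lemma jacobi_matrix_BII: "jacobi_matrix BII n = Jac n"
  unfolding jacobi_matrix_def
proof (rule the_equality)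
  have fin: "{m. Jac n m \<noteq> 0} \<subseteq> {..Suc n}"
    using Jac_upper not_le by blast
  have "[:0, 1:] * BII n = (\<Sum>m | Jac n m \<noteq> 0. Polynomial.smult (Jac n m) (BII m))"
    unfolding x_BII_expansion by (rule sum.mono_neutral_right) (use fin in auto)
  then show "finite {m. Jac n m \<noteq> 0} \<and>
      [:0, 1:] * BII n = (\<Sum>m | Jac n m \<noteq> 0. Polynomial.smult (Jac n m) (BII m))"
    using fin finite_subset by blast
next
  fix c assume c: "finite {m. c m \<noteq> 0} \<and>
      [:0, 1:] * BII n = (\<Sum>m | c m \<noteq> 0. Polynomial.smult (c m) (BII m))"
  show "c = Jac n"
  proof
    fix m
    have "Jac n m = (if m \<in> {m. c m \<noteq> 0} then c m else 0)"
      unfolding Jac_def using c by (simp only: BII_coordinate)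
    then show "c m = Jac n m" by auto
  qed
qed

end

text \<open>\<open>s j\<close> plays the role of the index with
  \<open>\<xi> (s j) = x * \<xi> j\<close>, and \<open>N\<close> bounds how far this index
  advances.\<close>

locale shifted_orthogonality_form = orthogonality_form +
  fixes s :: "nat \<Rightarrow> nat" and N :: nat
  assumes beta_shift: "\<beta> ([:0, 1:] * P) j = \<beta> P (s j)"
    and s_le: "s j \<le> j + N"
begin

text \<open>Moving the factor \<open>x\<close> over to the form leaves functions of index at most
  \<open>m + N < n\<close>, all orthogonal to \<open>BII n\<close>.\<close>

lemma Jac_lower:
  assumes "m + N < n"
  shows "Jac n m = 0"
proof -
  have "\<beta> (BII n) (s j) = 0" if "j \<le> m" for j
    using that s_le[of j] assms by (intro beta_BII_eq_0) linarith
  then show ?thesis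
    by (simp only: Jac_def pair_form_def beta_shift) simp
qed

text \<open>\<open>X j\<close> stands for the value of \<open>\<xi> j\<close> at \<open>lam\<close>,
  which may lie outside \<open>\<Delta>\<close>. Multiplication by \<open>lam\<close> turns
  \<open>X j\<close> into \<open>X (s j)\<close>, which \<open>CI_dual_expansion\<close> re-expands
  in the \<open>Q m\<close>.\<close>

lemma form_recurrence:
  fixes X :: "nat \<Rightarrow> real"
  assumes X: "\<And>j. X (s j) = lam * X j" and K: "k + N \<le> K"
  defines "Q \<equiv> \<lambda>l. \<Sum>j\<le>l. CI l j * X j"
  shows "lam * Q k = (\<Sum>m\<le>K. Jac m k * Q m)"
proof -
  have Q: "Q m = (\<Sum>j\<le>K. CI m j * X j)" if "m \<le> K" for m
    unfolding Q_def by (rule sum.mono_neutral_left) (use that CI_eq_0 in auto)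
  have X_expand: "X i = (\<Sum>m\<le>K. \<beta> (BII m) i * Q m)" if "i \<le> K" for i
  proof -
    have "(\<Sum>m\<le>K. \<beta> (BII m) i * Q m) = (\<Sum>m\<le>K. \<Sum>j\<le>K. \<beta> (BII m) i * CI m j * X j)"
      by (intro sum.cong) (auto simp: Q sum_distrib_left mult.assoc)
    also have "\<dots> = (\<Sum>j\<le>K. (\<Sum>m\<le>K. \<beta> (BII m) i * CI m j) * X j)"
      by (subst sum.swap) (simp add: sum_distrib_right)
    also have "\<dots> = (\<Sum>j\<le>K. if j = i then X i else 0)"
      using CI_dual_expansion[OF that] by (intro sum.cong) auto
    finally show ?thesis using that by simp
  qed
  have "lam * Q k = (\<Sum>j\<le>k. CI k j * X (s j))"
    by (simp add: Q_def sum_distrib_left X mult_ac)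
  also have "\<dots> = (\<Sum>j\<le>k. \<Sum>m\<le>K. CI k j * \<beta> (BII m) (s j) * Q m)"
  proof (intro sum.cong refl)
    fix j assume "j \<in> {..k}"
    then have "s j \<le> K" using s_le[of j] K by simp
    from X_expand[OF this] show "CI k j * X (s j) = (\<Sum>m\<le>K. CI k j * \<beta> (BII m) (s j) * Q m)"
      by (simp add: sum_distrib_left mult.assoc)
  qed
  also have "\<dots> = (\<Sum>m\<le>K. Jac m k * Q m)"
    by (subst sum.swap) (simp only: Jac_def pair_form_def beta_shift sum_distrib_right)
  finally show ?thesis .
qed

text \<open>The Christoffel--Darboux formula on the diagonal: \<open>\<Sum>k<n. lam * B k * Q k\<close> is computed with the
  recurrence of the \<open>B k\<close> and with that of the \<open>Q k\<close>, and only the terms of \<open>J\<close> coupling an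
  index below \<open>n\<close> with one above survive in the difference.\<close>

lemma christoffel_darboux_diagonal:
  fixes X :: "nat \<Rightarrow> real"
  assumes X: "\<And>j. X (s j) = lam * X j" and n: "1 \<le> n"
  defines "Q \<equiv> \<lambda>l. \<Sum>j\<le>l. CI l j * X j"
  shows "(\<Sum>m=n..<n+N. \<Sum>k<n. Jac m k * Q m * poly (BII k) lam) = Q (n - 1) * poly (BII n) lam"
proof -
  define b where "b k = poly (BII k) lam" for k
  have b: "lam * b k = (\<Sum>m<n. Jac k m * b m) + (if k = n - 1 then b n else 0)" if "k < n" for k
  proof -
    have "lam * b k = poly ([:0, 1:] * BII k) lam"
      by (simp add: b_def)
    also have "\<dots> = (\<Sum>m\<le>Suc k. Jac k m * b m)"
      by (subst x_BII_expansion) (simp only: poly_sum poly_smult b_def)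
    also have "\<dots> = (\<Sum>m\<le>n. Jac k m * b m)"
      by (rule sum.mono_neutral_left) (use that Jac_upper in auto)
    also have "\<dots> = (\<Sum>m<n. Jac k m * b m) + Jac k n * b n"
      by (simp flip: lessThan_Suc_atMost)
    also have "Jac k n * b n = (if k = n - 1 then b n else 0)"
      using that Jac_super[of k] Jac_upper[of k n] by (cases "k = n - 1") auto
    finally show ?thesis .
  qed
  have q: "lam * Q k = (\<Sum>m<n. Jac m k * Q m) + (\<Sum>m=n..<n+N. Jac m k * Q m)" if "k < n" for k
  proof -
    \<comment> \<open>For \<open>k < n\<close> the band ends at \<open>n + N - 1\<close> or earlier,
      so one upper limit serves all \<open>k\<close>.\<close>
    have "lam * Q k = (\<Sum>m\<le>n+N-1. Jac m k * Q m)"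
      unfolding Q_def by (rule form_recurrence) (use X that in auto)
    also have "{..n+N-1} = {..<n} \<union> {n..<n+N}"
      using n by auto
    also have "(\<Sum>m\<in>\<dots>. Jac m k * Q m) = (\<Sum>m<n. Jac m k * Q m) + (\<Sum>m=n..<n+N. Jac m k * Q m)"
      by (rule sum.union_disjoint) auto
    finally show ?thesis .
  qed
  have 1: "(\<Sum>k<n. lam * b k * Q k) =
      (\<Sum>k<n. \<Sum>m<n. Jac k m * b m * Q k) + Q (n - 1) * b n"
  proof -
    have "(\<Sum>k<n. lam * b k * Q k) =
        (\<Sum>k<n. (\<Sum>m<n. Jac k m * b m * Q k) + (if k = n - 1 then b n * Q (n - 1) else 0))"
      by (intro sum.cong) (auto simp: b distrib_right sum_distrib_right)
    then show ?thesis
      using n by (simp add: sum.distrib mult.commute)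
  qed
  have 2: "(\<Sum>k<n. lam * b k * Q k) =
      (\<Sum>k<n. \<Sum>m<n. Jac m k * Q m * b k) + (\<Sum>k<n. \<Sum>m=n..<n+N. Jac m k * Q m * b k)"
  proof -
    have "(\<Sum>k<n. lam * b k * Q k) = (\<Sum>k<n. lam * Q k * b k)"
      by (simp add: mult_ac)
    also have "\<dots> = (\<Sum>k<n. (\<Sum>m<n. Jac m k * Q m * b k) + (\<Sum>m=n..<n+N. Jac m k * Q m * b k))"
      by (intro sum.cong) (auto simp: q distrib_right sum_distrib_right)
    finally show ?thesis by (simp add: sum.distrib)
  qed
  \<comment> \<open>The part with both indices below \<open>n\<close> is the same in
    \<open>1\<close> and \<open>2\<close> after exchanging the indices, and cancels.\<close>
  have 3: "(\<Sum>k<n. \<Sum>m<n. Jac k m * b m * Q k) = (\<Sum>k<n. \<Sum>m<n. Jac m k * Q m * b k)"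
    by (subst sum.swap) (simp add: mult_ac)
  have "(\<Sum>m=n..<n+N. \<Sum>k<n. Jac m k * Q m * b k) = Q (n - 1) * b n"
    using 1 2 3 by (subst sum.swap) simp
  then show ?thesis by (simp add: b_def)
qed

end

section \<open>The limiting characteristic polynomial\<close>

text \<open>Telescoping: \<open>b (n + k) / b n\<close> is eventually a product of \<open>k\<close>
  consecutive ratios, each tending to \<open>r\<close>.\<close>

lemma quotient_limit:
  fixes b :: "nat \<Rightarrow> real"
  assumes lim: "(\<lambda>n. b (n + 1) / b n) \<longlonglongrightarrow> r" and r: "r \<noteq> 0"
  shows "(\<lambda>n. b n / b (n + k)) \<longlonglongrightarrow> (1 / r) ^ k"
proof -
  have "eventually (\<lambda>n. b (n + 1) / b n \<noteq> 0) sequentially"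
    by (rule tendsto_imp_eventually_ne[OF lim r])
  \<comment> \<open>Division by zero yields \<open>0\<close>, so a nonzero ratio already forces
    \<open>b n\<close> to be nonzero.\<close>
  then have nz: "eventually (\<lambda>n. b n \<noteq> 0) sequentially"
    by (rule eventually_mono) auto
  show ?thesis
  proof (induction k)
    case 0
    have "eventually (\<lambda>n. b n / b (n + 0) = (1 / r) ^ 0) sequentially"
      using nz by (rule eventually_mono) simp
    then show ?case by (rule tendsto_eventually)
  next
    case (Suc k)
    have "(\<lambda>n. b ((n + k) + 1) / b (n + k)) \<longlonglongrightarrow> r"
      by (rule LIMSEQ_ignore_initial_segment[OF lim])
    then have "(\<lambda>n. (b n / b (n + k)) / (b ((n + k) + 1) / b (n + k))) \<longlonglongrightarrow> (1 / r) ^ k / r"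
      by (rule tendsto_divide[OF Suc.IH _ r])
    \<comment> \<open>The cancelled factor is \<open>b (n + k)\<close>, hence nonvanishing at all
      later indices is invoked.\<close>
    moreover have "eventually (\<lambda>n. (b n / b (n + k)) / (b ((n + k) + 1) / b (n + k)) =
        b n / b (n + Suc k)) sequentially"
      using eventually_all_ge_at_top[OF nz] by (rule eventually_mono) auto
    ultimately have "(\<lambda>n. b n / b (n + Suc k)) \<longlonglongrightarrow> (1 / r) ^ k / r"
      by (rule Lim_transform_eventually)
    then show ?case by simp
  qed
qed

text \<open>For \<open>i < N\<close> this is the limit of the recurrence coefficient at index
  \<open>i + 1\<close>; up to sign, the same sums are the coefficients in the synthetic division of
  \<open>phi_star\<close> by \<open>[:1, - r:]\<close>.\<close>

definition limit_coeff :: "nat \<Rightarrow> (nat \<Rightarrow> real) \<Rightarrow> real \<Rightarrow> nat \<Rightarrow> real" where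
  "limit_coeff N c r i = (\<Sum>k=1..N - i. c (i + k) / r ^ k)"

text \<open>One step of the synthetic division: multiplication by \<open>r\<close> splits off the
  term \<open>k = 1\<close> and shifts the others.\<close>

lemma limit_coeff_Suc:
  assumes "i < N" "r \<noteq> 0"
  shows "r * limit_coeff N c r i = c (Suc i) + limit_coeff N c r (Suc i)"
proof -
  obtain d where d: "N - i = Suc d" "N - Suc i = d"
    using assms by (metis Suc_diff_Suc)
  have "r * limit_coeff N c r i = (\<Sum>k=1..Suc d. c (i + k) / r ^ (k - 1))"
    unfolding limit_coeff_def d sum_distrib_left
  proof (intro sum.cong refl)
    fix k assume "k \<in> {1..Suc d}"
    then obtain m where "k = Suc m" by (cases k) auto
    then show "r * (c (i + k) / r ^ k) = c (i + k) / r ^ (k - 1)"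
      using assms by simp
  qed
  also have "\<dots> = (\<Sum>k=0..d. c (Suc i + k) / r ^ k)"
    using sum.shift_bounds_cl_Suc_ivl[of "\<lambda>k. c (i + k) / r ^ (k - 1)" 0 d] by simp
  also have "\<dots> = c (Suc i) + limit_coeff N c r (Suc i)"
    by (simp add: sum.atLeast_Suc_atMost[of 0 d] limit_coeff_def d)
  finally show ?thesis .
qed

lemma poly_phi:
  "poly (phi N c lam) r = (\<Sum>j=1..N. c j * r ^ (N - j)) + (c 0 - lam) * r ^ N + r ^ (N + 1)"
  by (simp add: phi_def poly_sum poly_monom)

text \<open>The root equation divided by \<open>r ^ N\<close>; it closes the synthetic division
  without remainder.\<close>

lemma limit_coeff_0:
  assumes "poly (phi N c lam) r = 0" "r \<noteq> 0"
  shows "limit_coeff N c r 0 + r = - (c 0 - lam)"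
proof -
  have "r ^ N * limit_coeff N c r 0 = (\<Sum>j=1..N. c j * r ^ (N - j))"
    unfolding limit_coeff_def sum_distrib_left
    using assms(2) by (intro sum.cong) (auto simp: power_diff)
  then have "r ^ N * (limit_coeff N c r 0 + (c 0 - lam) + r) = 0"
    using assms(1) by (simp add: poly_phi algebra_simps)
  then show ?thesis
    using assms(2) by simp
qed

lemma rec_coeff_limit:
  assumes J_lim: "\<And>j. j \<le> N \<Longrightarrow> (\<lambda>n. J (n + j) n) \<longlonglongrightarrow> c j"
    and ratio: "(\<lambda>n. poly (B (n + 1)) lam / poly (B n) lam) \<longlonglongrightarrow> r" and r: "r \<noteq> 0"
    and i: "i \<le> N"
  shows "(\<lambda>n. rec_coeff N J B lam n i) \<longlonglongrightarrow> (if i = 0 then - 1 else limit_coeff N c r (i - 1))"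
proof (cases i)
  case 0
  then show ?thesis by (simp add: rec_coeff_def)
next
  case (Suc t)
  then have t: "t < N" using i by simp
  \<comment> \<open>Passing to \<open>n + N\<close> avoids the truncated subtraction
    \<open>n - N\<close>. Each entry of \<open>J\<close> then runs along the fixed subdiagonal
    \<open>N + t - j\<close>, where \<open>J_lim\<close> applies.\<close>
  have "(\<lambda>n. rec_coeff N J B lam (n + N) i) \<longlonglongrightarrow> (\<Sum>j=t..<N. c (N + t - j) * (1 / r) ^ (N - j))"
  proof -
    have eq: "rec_coeff N J B lam (n + N) i =
        (\<Sum>j=t..<N. J (n + j + (N + t - j)) (n + j) *
           (poly (B (n + j)) lam / poly (B (n + j + (N - j))) lam))" for n
    proof -
      have "rec_coeff N J B lam (n + N) i = (\<Sum>j=0..<N. (if t \<le> j then J (n + N + t) (n + j) else 0) *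
          (poly (B (n + j)) lam / poly (B (n + N)) lam))"
        using t Suc by (simp add: rec_coeff_def rec_matrix_def ratio_vec_def scalar_prod_def cong: if_cong)
      also have "\<dots> = (\<Sum>j=t..<N. (if t \<le> j then J (n + N + t) (n + j) else 0) *
          (poly (B (n + j)) lam / poly (B (n + N)) lam))"
        by (rule sum.mono_neutral_right) auto
      also have "\<dots> = (\<Sum>j=t..<N. J (n + j + (N + t - j)) (n + j) *
           (poly (B (n + j)) lam / poly (B (n + j + (N - j))) lam))"
      proof (intro sum.cong refl)
        fix j assume "j \<in> {t..<N}"
        then have "n + j + (N + t - j) = n + N + t" "n + j + (N - j) = n + N" "t \<le> j"
          by auto
        then show "(if t \<le> j then J (n + N + t) (n + j) else 0) *
            (poly (B (n + j)) lam / poly (B (n + N)) lam) =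
          J (n + j + (N + t - j)) (n + j) *
           (poly (B (n + j)) lam / poly (B (n + j + (N - j))) lam)"
          by presburger
      qed
      finally show ?thesis .
    qed
    show ?thesis
      unfolding eq
    proof (intro tendsto_sum tendsto_mult)
      fix j assume "j \<in> {t..<N}"
      then have "N + t - j \<le> N" by auto
      from LIMSEQ_ignore_initial_segment[OF J_lim[OF this], of j]
      show "(\<lambda>n. J (n + j + (N + t - j)) (n + j)) \<longlonglongrightarrow> c (N + t - j)" .
      from LIMSEQ_ignore_initial_segment[OF quotient_limit[OF ratio r, of "N - j"], of j]
      show "(\<lambda>n. poly (B (n + j)) lam / poly (B (n + j + (N - j))) lam) \<longlonglongrightarrow> (1 / r) ^ (N - j)" .
    qed
  qed
  also have "(\<Sum>j=t..<N. c (N + t - j) * (1 / r) ^ (N - j)) = limit_coeff N c r t"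
    unfolding limit_coeff_def
    by (rule sum.reindex_bij_witness[of _ "\<lambda>k. N - k" "\<lambda>j. N - j"])
      (use t in \<open>auto simp: power_divide add.commute\<close>)
  finally show ?thesis
    using Suc by (simp add: LIMSEQ_offset)
qed

lemma coeff_phi_star:
  "Polynomial.coeff (phi_star N c lam) n =
     (if n = 0 then 1 else if n = 1 then c 0 - lam else if n \<le> N + 1 then c (n - 1) else 0)"
proof -
  have phi: "Polynomial.coeff (phi N c lam) k =
      (\<Sum>j=1..N. if N - j = k then c j else 0) + (if N = k then c 0 - lam else 0) +
      (if N + 1 = k then 1 else 0)" for k
    by (simp add: phi_def coeff_sum)
  have sum: "(\<Sum>j=1..N. if N - j = k then c j else 0) = (if k < N then c (N - k) else 0)" for k
  proof -
    have "(\<Sum>j=1..N. if N - j = k then c j else 0) =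
        (\<Sum>j=1..N. if N - k = j then (if k < N then c j else 0) else 0)"
      by (intro sum.cong) auto
    then show ?thesis by auto
  qed
  show ?thesis
    unfolding phi_star_def coeff_reflect_poly degree_phi phi sum by auto
qed

text \<open>Coefficients are compared: degree \<open>1\<close> is \<open>limit_coeff_0\<close>,
  degrees \<open>2\<close> to \<open>N + 1\<close> are \<open>limit_coeff_Suc\<close>, and beyond
  that both sides vanish.\<close>

lemma char_poly_factorization:
  assumes J_lim: "\<And>j. j \<le> N \<Longrightarrow> (\<lambda>n. J (n + j) n) \<longlonglongrightarrow> c j"
    and ratio: "(\<lambda>n. poly (B (n + 1)) lam / poly (B n) lam) \<longlonglongrightarrow> r" and r: "r \<noteq> 0"
    and root: "poly (phi N c lam) r = 0"
  shows "phi_star N c lam = [:1, - r:] * - recurrence_char_poly N (rec_coeff N J B lam)"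
proof (rule poly_eqI)
  let ?P = "recurrence_char_poly N (rec_coeff N J B lam)"
  have lim: "(\<lambda>n. rec_coeff N J B lam n i) \<longlonglongrightarrow> (if i = 0 then - 1 else limit_coeff N c r (i - 1))"
    if "i \<le> N" for i
    by (rule rec_coeff_limit) (use J_lim ratio r that in auto)
  have "Polynomial.coeff ?P n = (\<Sum>i\<le>N. if i = n then lim (\<lambda>n. rec_coeff N J B lam n i) else 0)" for n
    by (simp add: recurrence_char_poly_def coeff_sum)
  \<comment> \<open>For \<open>n > N\<close> the sum \<open>limit_coeff N c r (n - 1)\<close> is
    empty, so the formula also gives the zero coefficients.\<close>
  then have P: "Polynomial.coeff ?P n = (if n = 0 then - 1 else limit_coeff N c r (n - 1))" for n
    using limI[OF lim[of n]]
    by (auto simp: limit_coeff_def)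
  fix n
  have "Polynomial.coeff ([:1, - r:] * - ?P) n =
      (case n of 0 \<Rightarrow> 0 | Suc m \<Rightarrow> r * Polynomial.coeff ?P m) - Polynomial.coeff ?P n"
    by (simp add: coeff_pCons split: nat.split)
  also have "\<dots> = Polynomial.coeff (phi_star N c lam) n"
  proof -
    consider "n = 0" | "n = 1" | t where "n = Suc (Suc t)" "t < N" | t where "n = Suc (Suc t)" "N \<le> t"
      by (metis One_nat_def not_less old.nat.exhaust)
    then show ?thesis
    proof cases
      case 2
      then show ?thesis
        using limit_coeff_0[OF root r] by (simp add: P coeff_phi_star)
    next
      case 3
      then show ?thesis
        using limit_coeff_Suc[OF _ r, of t N c] by (simp add: P coeff_phi_star)
    qed (auto simp: P coeff_phi_star limit_coeff_def)
  qed
  finally show "Polynomial.coeff (phi_star N c lam) n = Polynomial.coeff ([:1, - r:] * - ?P) n" ..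
qed

section \<open>Reflection of polynomials: roots and multiplicities under inversion\<close>

lemma reflect_poly_linear: "reflect_poly [:- a, 1:] = [:1, - a:]" for a :: "'a::field"
  by (rule poly_eqI) (auto simp: coeff_reflect_poly coeff_pCons split: nat.split)

lemma map_poly_of_real_reflect:
  "map_poly complex_of_real (reflect_poly q) = reflect_poly (map_poly complex_of_real q)"
  by (rule poly_eqI) (simp add: coeff_map_poly coeff_reflect_poly degree_map_poly)

lemma map_poly_of_real_mult:
  "map_poly complex_of_real (a * b) = map_poly complex_of_real a * map_poly complex_of_real b"
  by (rule poly_eqI) (simp add: coeff_map_poly coeff_mult)

text \<open>Over the complex numbers the monic \<open>q\<close> splits into linear factors
  \<open>[:- z, 1:]\<close>, each reflecting to \<open>[:1, - z:]\<close>; the factor belonging to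
  \<open>a\<close> is then cancelled.\<close>

lemma reflected_roots_product:
  fixes q :: "real poly" and a :: real and r :: "nat \<Rightarrow> complex"
  assumes roots: "proots (map_poly complex_of_real q) =
      add_mset (complex_of_real a) (image_mset r (mset_set {1..N}))"
    and monic: "lead_coeff q = 1"
    and factor: "reflect_poly q = [:1, - a:] * - P"
  shows "map_poly complex_of_real P = - (\<Prod>i=1..N. [:1, - r i:])"
proof -
  have "map_poly complex_of_real q = (\<Prod>x\<in>#proots (map_poly complex_of_real q). [:- x, 1:])"
    using complex_poly_decompose_multiset[of "map_poly complex_of_real q"] monic
    by (simp add: coeff_map_poly degree_map_poly)
  also have "\<dots> = [:- complex_of_real a, 1:] * (\<Prod>i=1..N. [:- r i, 1:])"
    unfolding roots by (simp add: prod_unfold_prod_mset multiset.map_comp o_def)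
  finally have "map_poly complex_of_real (reflect_poly q) =
      [:1, - complex_of_real a:] * (\<Prod>i=1..N. [:1, - r i:])"
    by (simp only: map_poly_of_real_reflect reflect_poly_mult reflect_poly_prod reflect_poly_linear)
  moreover have "map_poly complex_of_real (reflect_poly q) =
      [:1, - complex_of_real a:] * map_poly complex_of_real (- P)"
    unfolding factor map_poly_of_real_mult by (simp add: map_poly_pCons)
  ultimately have "[:1, - complex_of_real a:] * map_poly complex_of_real (- P) =
      [:1, - complex_of_real a:] * (\<Prod>i=1..N. [:1, - r i:])"
    by (simp only:)
  then have "map_poly complex_of_real (- P) = (\<Prod>i=1..N. [:1, - r i:])"
    by (subst (asm) mult_left_cancel) auto
  moreover have "map_poly complex_of_real (- P) = - map_poly complex_of_real P"
    by (rule poly_eqI) (simp add: coeff_map_poly)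
  ultimately show ?thesis
    by (metis minus_minus)
qed

text \<open>Reflection is multiplicative and sends \<open>[:- a, 1:]\<close> to a nonzero multiple
  of \<open>[:- (1 / a), 1:]\<close>. The cofactor, nonzero at \<open>a\<close>, reflects to one
  that is nonzero at \<open>1 / a\<close>.\<close>

lemma order_reflect_poly:
  fixes q :: "'a::field poly"
  assumes "a \<noteq> 0" "q \<noteq> 0"
  shows "Polynomial.order (1 / a) (reflect_poly q) = Polynomial.order a q"
proof -
  define m where "m = Polynomial.order a q"
  obtain R where R: "q = [:- a, 1:] ^ m * R" "\<not> [:- a, 1:] dvd R"
    using order_decomp[OF assms(2)] m_def by blast
  have "reflect_poly q = [:1, - a:] ^ m * reflect_poly R"
    by (simp add: R reflect_poly_mult reflect_poly_power reflect_poly_linear)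
  also have "[:1, - a:] = Polynomial.smult (- a) [:- (1 / a), 1:]"
    using assms by simp
  finally have eq: "reflect_poly q =
      Polynomial.smult ((- a) ^ m) ([:- (1 / a), 1:] ^ m * reflect_poly R)"
    by (simp only: smult_power mult_smult_left)
  have "poly R a \<noteq> 0"
    using R(2) by (simp add: poly_eq_0_iff_dvd)
  then have nz: "poly (reflect_poly R) (1 / a) \<noteq> 0"
    using assms by (simp add: poly_reflect_poly_nz)
  then have "reflect_poly R \<noteq> 0" by auto
  then have "Polynomial.order (1 / a) (reflect_poly q) =
      Polynomial.order (1 / a) ([:- (1 / a), 1:] ^ m) + Polynomial.order (1 / a) (reflect_poly R)"
    unfolding eq using assms by (subst order_smult, simp, subst order_mult) auto
  also have "\<dots> = m"
    using nz by (simp only: order_power_n_n order_0I[OF nz] add_0_right)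
  finally show ?thesis by (simp add: m_def)
qed

text \<open>The factor \<open>[:1, - a:]\<close> has a simple zero at \<open>1 / a\<close>, which
  accounts for the multiplicity lost in the quotient.\<close>

lemma order_factor:
  fixes q :: "'a::field poly"
  assumes "a \<noteq> 0" "q \<noteq> 0" and factor: "reflect_poly q = [:1, - a:] * - P"
  shows "Polynomial.order a q = Suc (Polynomial.order (1 / a) P)"
proof -
  have "reflect_poly q \<noteq> 0"
    unfolding reflect_poly_eq_0_iff by (rule assms(2))
  then have "Polynomial.order (1 / a) (reflect_poly q) =
      Polynomial.order (1 / a) [:1, - a:] + Polynomial.order (1 / a) (- P)"
    unfolding factor by (rule order_mult)
  moreover have "[:1, - a:] = Polynomial.smult (- a) ([:- (1 / a), 1:] ^ 1)"
    using assms by simp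
  then have "Polynomial.order (1 / a) [:1, - a:] = 1"
    using assms(1) by (metis order_smult order_power_n_n neg_equal_0_iff_equal)
  ultimately show ?thesis
    using order_reflect_poly[OF assms(1,2)] by simp
qed

section \<open>The step line and the moment form\<close>

locale step_line =
  fixes p :: nat and nv :: "nat \<Rightarrow> nat"
  assumes p: "1 \<le> p" and nv: "\<And>a. a \<in> {1..p} \<Longrightarrow> 1 \<le> nv a"
begin

abbreviation "block_size \<equiv> abs_index p nv"

abbreviation offset :: "nat \<Rightarrow> nat" where
  "offset a \<equiv> (\<Sum>b=1..<a. nv b)"

lemma offset_mono:
  assumes "1 \<le> a" "a < b"
  shows "offset a + nv a \<le> offset b"
proof -
  have "offset a + nv a = offset (Suc a)"
    using assms by simp
  also have "\<dots> \<le> offset b"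
    using assms by (intro sum_mono2) auto
  finally show ?thesis .
qed

lemma offset_le_block: "a \<in> {1..p} \<Longrightarrow> offset a + nv a \<le> block_size"
  using offset_mono[of a "Suc p"] by (auto simp: abs_index_def atLeastLessThanSuc_atLeastAtMost)

lemma block_unique:
  assumes "a \<in> {1..p}" "b \<in> {1..p}" "r < nv a" "t < nv b" "offset a + r = offset b + t"
  shows "a = b" "r = t"
proof -
  show "a = b"
    using offset_mono[of a b] offset_mono[of b a] assms by (cases a b rule: linorder_cases) auto
  then show "r = t" using assms by simp
qed

lemma block_exists:
  assumes "x < block_size"
  shows "\<exists>a\<in>{1..p}. \<exists>r<nv a. x = offset a + r"
proof -
  have "x < (\<Sum>b=1..m. nv b) \<Longrightarrow> \<exists>a\<in>{1..m}. \<exists>r<nv a. x = offset a + r" for m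
  proof (induction m)
    case (Suc m)
    show ?case
    proof (cases "x < (\<Sum>b=1..m. nv b)")
      case True
      then obtain a r where "a \<in> {1..m}" "r < nv a" "x = offset a + r"
        using Suc.IH by blast
      then show ?thesis by (intro bexI[of _ a] exI[of _ r]) auto
    next
      case False
      then have "x = offset (Suc m) + (x - offset (Suc m))" "x - offset (Suc m) < nv (Suc m)"
        using Suc.prems by (auto simp: atLeastLessThanSuc_atLeastAtMost)
      then show ?thesis by (intro bexI[of _ "Suc m"] exI[of _ "x - offset (Suc m)"]) auto
    qed
  qed simp
  from this[of p] show ?thesis
    using assms by (simp add: abs_index_def)
qed

text \<open>Since \<open>offset a + r < block_size\<close>, division with remainder recovers
  \<open>q\<close>, and \<open>block_unique\<close> recovers \<open>a\<close> and \<open>r\<close>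
  from the remainder.\<close>

lemma index_decomp_eq:
  assumes "a \<in> {1..p}" "r < nv a"
  shows "index_decomp p nv (q * block_size + offset a + r) = (q, a, r)"
proof -
  let ?i = "q * block_size + offset a + r"
  have *: "q' = i div block_size \<and> offset a' + r' = i mod block_size"
    if "a' \<in> {1..p}" "r' < nv a'" "i = q' * block_size + offset a' + r'" for q' a' r' i
  proof -
    have lt: "offset a' + r' < block_size"
      using offset_le_block[OF that(1)] that(2) by linarith
    have "i = (offset a' + r') + q' * block_size"
      using that(3) by simp
    then show ?thesis
      using lt by (simp del: add.assoc)
  qed
  have "q' = q \<and> a' = a \<and> r' = r"
    if "a' \<in> {1..p}" "r' < nv a'" "?i = q' * block_size + offset a' + r'" for q' a' r'
    using *[OF that] *[OF assms refl, of q] block_unique[of a' a r' r] that assms by simp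
  then show ?thesis
    unfolding index_decomp_def using assms by (intro the_equality) auto
qed

text \<open>The number \<open>i\<close> with \<open>a(i) = a\<close> and \<open>k(i) = k\<close>.\<close>

definition index_of :: "nat \<Rightarrow> nat \<Rightarrow> nat" where
  "index_of a k = (k div nv a) * block_size + offset a + k mod nv a"

lemma index_decomp_index_of:
  assumes "a \<in> {1..p}"
  shows "index_decomp p nv (index_of a k) = (k div nv a, a, k mod nv a)"
  unfolding index_of_def
  using assms nv[OF assms] by (intro index_decomp_eq) auto

lemma xi_index_of:
  assumes "a \<in> {1..p}"
  shows "xi p nv w (index_of a k) x = x ^ k * w a x"
  by (simp add: xi_def index_decomp_index_of[OF assms])

lemma index_of_inj:
  assumes "a \<in> {1..p}" "b \<in> {1..p}" "index_of a k = index_of b m"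
  shows "a = b \<and> k = m"
  using index_decomp_index_of[OF assms(1), of k] index_decomp_index_of[OF assms(2), of m] assms(3)
  by (metis div_mult_mod_eq prod.inject)

lemma index_of_surj: "\<exists>a\<in>{1..p}. \<exists>k. i = index_of a k"
proof -
  have "1 \<le> nv 1" using nv[of 1] p by simp
  then have "0 < block_size" using offset_le_block[of 1] p by simp
  then obtain a r where a: "a \<in> {1..p}" "r < nv a" "i mod block_size = offset a + r"
    using block_exists[of "i mod block_size"] by auto
  have "i = index_of a ((i div block_size) * nv a + r)"
    using a div_mult_mod_eq[of i block_size] by (simp add: index_of_def)
  then show ?thesis using a(1) by blast
qed

text \<open>Inside a block the index advances by one; at the end of the block it must pass the
  blocks of all other weights. The largest such jump is \<open>band_width\<close>.\<close>

lemma index_of_Suc: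
  assumes "a \<in> {1..p}"
  shows "index_of a (Suc k) =
    index_of a k + (if Suc (k mod nv a) = nv a then block_size - nv a + 1 else 1)"
proof (cases "Suc (k mod nv a) = nv a")
  case True
  moreover have "nv a \<le> block_size"
    using offset_le_block[OF assms] by simp
  ultimately show ?thesis
    by (simp add: index_of_def div_Suc mod_Suc)
next
  case False
  then show ?thesis
    by (simp add: index_of_def div_Suc mod_Suc)
qed

lemma index_of_less:
  assumes "a \<in> {1..p}"
  shows "k < m \<Longrightarrow> index_of a k < index_of a m"
  by (rule lift_Suc_mono_less[of "index_of a"]) (use index_of_Suc[OF assms] in auto)

lemma index_of_ge:
  assumes "a \<in> {1..p}"
  shows "k \<le> index_of a k"
proof (induction k)
  case (Suc k)
  then show ?case using index_of_less[OF assms lessI[of k]] by linarith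
qed simp

lemma index_of_Suc_le:
  assumes "a \<in> {1..p}"
  shows "index_of a (Suc k) \<le> index_of a k + band_width p nv"
proof -
  have "block_size - nv a + 1 \<le> band_width p nv"
    unfolding band_width_def using assms by (intro Max_ge) auto
  then show ?thesis
    by (simp add: index_of_Suc[OF assms])
qed

text \<open>Ensures that \<open>n - 1\<close> is a true predecessor whenever \<open>n\<close> is at
  least the band width.\<close>

lemma band_width_pos: "1 \<le> band_width p nv"
proof -
  have "block_size - nv 1 + 1 \<le> band_width p nv"
    unfolding band_width_def using p by (intro Max_ge) auto
  then show ?thesis by linarith
qed

text \<open>Multiplying \<open>\<xi> i\<close> by \<open>x\<close> keeps its weight and raises its
  exponent by one; this is the resulting index.\<close>

definition shift :: "nat \<Rightarrow> nat" where
  "shift i = (case index_decomp p nv i of (q, a, r) \<Rightarrow> index_of a (Suc (q * nv a + r)))"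

lemma shift_index_of: "a \<in> {1..p} \<Longrightarrow> shift (index_of a k) = index_of a (Suc k)"
  by (simp add: shift_def index_decomp_index_of)

lemma shift_le: "shift i \<le> i + band_width p nv"
  using index_of_surj[of i] shift_index_of index_of_Suc_le by auto

lemma xi_shift: "xi p nv w (shift i) x = x * xi p nv w i x"
  using index_of_surj[of i] by (auto simp: shift_index_of xi_index_of)

text \<open>The multi-index of the step line whose orthogonality conditions are those given by
  \<open>\<xi>\<close> at the indices below \<open>l\<close>.\<close>

definition step_index :: "nat \<Rightarrow> nat \<Rightarrow> nat" where
  "step_index l a = card {k. index_of a k < l}"

lemma finite_index_of_less: "a \<in> {1..p} \<Longrightarrow> finite {k. index_of a k < l}"
  by (rule finite_subset[of _ "{..<l}"]) (auto intro: le_less_trans[OF index_of_ge])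

text \<open>As \<open>index_of a\<close> is increasing, the set counted by
  \<open>step_index l a\<close> is an initial segment of the naturals.\<close>

lemma less_step_index:
  assumes a: "a \<in> {1..p}" and k: "k < step_index l a"
  shows "index_of a k < l"
proof (rule ccontr)
  assume "\<not> index_of a k < l"
  then have "m < k" if "index_of a m < l" for m
    using index_of_less[OF a, of k m] that by (cases k m rule: linorder_cases) auto
  then have "card {m. index_of a m < l} \<le> card {..<k}"
    by (intro card_mono) auto
  then show False
    using k by (simp add: step_index_def)
qed

text \<open>The indices below \<open>l\<close> are partitioned according to their weight, so the
  degree in the normality condition is \<open>l\<close>.\<close>

lemma sum_step_index: "(\<Sum>a=1..p. step_index l a) = l"
proof -
  have "l = card {..<l}" by simp
  also have "{..<l} = (\<Union>a\<in>{1..p}. index_of a ` {k. index_of a k < l})"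
    using index_of_surj by fastforce
  also have "card \<dots> = (\<Sum>a=1..p. card (index_of a ` {k. index_of a k < l}))"
  proof (rule card_UN_disjoint)
    show "\<forall>a\<in>{1..p}. finite (index_of a ` {k. index_of a k < l})"
      using finite_index_of_less by blast
    show "\<forall>a\<in>{1..p}. \<forall>b\<in>{1..p}. a \<noteq> b \<longrightarrow>
        index_of a ` {k. index_of a k < l} \<inter> index_of b ` {k. index_of b k < l} = {}"
      using index_of_inj by blast
  qed simp
  also have "\<dots> = (\<Sum>a=1..p. step_index l a)"
    unfolding step_index_def
    by (intro sum.cong refl card_image inj_onI) (use index_of_inj in blast)
  finally show ?thesis ..
qed

end

section \<open>The moment form of the measure and its identification with the abstract
  system\<close>

lemma set_integral_sum:
  fixes f :: "'b \<Rightarrow> 'a \<Rightarrow> real"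
  assumes "\<And>i. i \<in> S \<Longrightarrow> set_integrable M A (f i)"
  shows "set_integrable M A (\<lambda>x. \<Sum>i\<in>S. f i x)"
    and "(LINT x:A|M. (\<Sum>i\<in>S. f i x)) = (\<Sum>i\<in>S. LINT x:A|M. f i x)"
  using assms unfolding set_integrable_def set_lebesgue_integral_def
  by (simp_all add: sum_distrib_left)

context
  fixes \<Delta> :: "real set" and \<sigma> :: real and M :: "real measure"
    and p :: nat and nv :: "nat \<Rightarrow> nat" and w :: "nat \<Rightarrow> real \<Rightarrow> real"
  assumes setting: "mop_setting \<Delta> \<sigma> M p nv w"
begin

lemma step_line_setting: "step_line p nv"
  using setting by unfold_locales (auto simp: mop_setting_def)

text \<open>The integrand is a finite combination of the functions
  \<open>x ^ (i + k) * w a x\<close>, integrable by finiteness of the moments.\<close>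

lemma integrable_poly_xi: "set_integrable M \<Delta> (\<lambda>x. poly P x * xi p nv w j x)"
proof -
  interpret step_line p nv by (rule step_line_setting)
  obtain a k where a: "a \<in> {1..p}" and j: "j = index_of a k"
    using index_of_surj[of j] by blast
  have "set_integrable M \<Delta> (\<lambda>x. \<Sum>i\<le>degree P. Polynomial.coeff P i * (x ^ (i + k) * w a x))"
    using setting a unfolding mop_setting_def
    by (intro set_integral_sum(1) set_integrable_mult_right) auto
  then show ?thesis
    by (simp add: j xi_index_of[OF a] poly_altdef power_add sum_distrib_right mult.assoc)
qed

definition moment :: "real poly \<Rightarrow> nat \<Rightarrow> real" where
  "moment P j = signed_integral \<Delta> \<sigma> M (\<lambda>x. poly P x * xi p nv w j x)"

text \<open>Perfectness enters here: nondegeneracy at \<open>l\<close> is normality of the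
  multi-index \<open>step_index l\<close>.\<close>

lemma shifted_orthogonality_form_moment:
  "shifted_orthogonality_form moment (step_line.shift p nv) (band_width p nv)"
proof -
  interpret step_line p nv by (rule step_line_setting)
  show ?thesis
  proof
    fix P R j
    show "moment (P + R) j = moment P j + moment R j"
      using set_integral_add(2)[OF integrable_poly_xi[of P j] integrable_poly_xi[of R j]]
      by (simp add: moment_def signed_integral_def algebra_simps)
  next
    fix a P j
    show "moment (Polynomial.smult a P) j = a * moment P j"
      by (simp only: moment_def signed_integral_def poly_smult mult.assoc set_integral_mult_right)
        (rule mult.left_commute)
  next
    fix P :: "real poly" and l
    assume P: "P \<noteq> 0" "degree P \<le> l" and orth: "\<And>j. j < l \<Longrightarrow> moment P j = 0"
    have "signed_integral \<Delta> \<sigma> M (\<lambda>x. poly P x * (x ^ k * w a x)) = 0"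
      if "a \<in> {1..p}" "k < step_index l a" for a k
      using orth[OF less_step_index[OF that]] by (simp add: moment_def xi_index_of[OF that(1)])
    moreover have "normal_index (signed_integral \<Delta> \<sigma> M) p w (step_index l)"
      using setting by (simp add: mop_setting_def perfect_system_def)
    ultimately show "degree P = l"
      using P unfolding normal_index_def sum_step_index by blast
  next
    fix P j
    show "moment ([:0, 1:] * P) j = moment P (shift j)"
      by (simp add: moment_def xi_shift mult_ac)
  next
    show "shift j \<le> j + band_width p nv" for j
      by (rule shift_le)
  qed
qed

interpretation shifted_orthogonality_form moment "step_line.shift p nv" "band_width p nv"
  by (rule shifted_orthogonality_form_moment)

lemma type_II_poly_eq: "type_II_poly (signed_integral \<Delta> \<sigma> M) (xi p nv w) = BII"
  by (simp add: fun_eq_iff type_II_poly_def BII_def is_typeII_def moment_def)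

text \<open>Interchanging the integral with the finite sum turns the defining conditions into
  pairings with monomials.\<close>

lemma type_I_coeff_eq: "type_I_coeff (signed_integral \<Delta> \<sigma> M) (xi p nv w) = CI"
proof -
  have "signed_integral \<Delta> \<sigma> M (\<lambda>x. x ^ i * (\<Sum>j\<le>l. c j * xi p nv w j x)) =
      pair_form l c (monom 1 i)" for i l c
  proof -
    have "(LINT x:\<Delta>|M. x ^ i * (\<Sum>j\<le>l. c j * xi p nv w j x)) =
        (LINT x:\<Delta>|M. \<Sum>j\<le>l. c j * (poly (monom 1 i) x * xi p nv w j x))"
      by (simp add: poly_monom sum_distrib_left mult_ac)
    also have "\<dots> = (\<Sum>j\<le>l. LINT x:\<Delta>|M. c j * (poly (monom 1 i) x * xi p nv w j x))"
      using integrable_poly_xi[of "monom 1 i"]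
      by (intro set_integral_sum(2) set_integrable_mult_right) auto
    finally show ?thesis
      by (simp add: signed_integral_def pair_form_def moment_def sum_distrib_left mult_ac)
  qed
  then show ?thesis
    by (simp add: fun_eq_iff type_I_coeff_def CI_def is_typeI_def)
qed

text \<open>This is \<open>christoffel_darboux_diagonal\<close> divided by the value of
  \<open>B n\<close> at \<open>lam\<close>; the band of \<open>Jac\<close> reduces the double sum to
  the triangle of \<open>rec_matrix\<close>.\<close>

lemma typeI_recurrence:
  fixes lam :: real and n :: nat
  defines "I \<equiv> signed_integral \<Delta> \<sigma> M" and "N \<equiv> band_width p nv"
  defines "B \<equiv> type_II_poly I (xi p nv w)" and "Q \<equiv> type_I_form I (xi p nv w)"
  assumes n: "N \<le> n" and nz: "poly (B n) lam \<noteq> 0"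
  shows "scalar_prod (Matrix.vec N (\<lambda>i. Q (n + i) lam))
           (rec_matrix N (jacobi_matrix B) n *\<^sub>v ratio_vec N B lam n) = Q (n - 1) lam"
proof -
  interpret step_line p nv by (rule step_line_setting)
  define q where "q m = Q m lam" for m
  define b where "b m = poly (B m) lam" for m
  have B: "B = BII" and J: "jacobi_matrix B = Jac"
    by (auto simp: B_def I_def type_II_poly_eq jacobi_matrix_BII fun_eq_iff)
  have q: "q = (\<lambda>l. \<Sum>j\<le>l. CI l j * xi p nv w j lam)"
    by (simp add: q_def Q_def I_def type_I_form_def type_I_coeff_eq fun_eq_iff)
  have "1 \<le> n"
    using band_width_pos n by (simp add: N_def)
  from christoffel_darboux_diagonal[of "\<lambda>j. xi p nv w j lam", OF xi_shift this]
  have "q (n - 1) * b n = (\<Sum>m=n..<n+N. \<Sum>k<n. Jac m k * q m * b k)"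
    by (simp add: q b_def B N_def)
  also have "\<dots> = (\<Sum>i<N. \<Sum>k<n. Jac (n + i) k * q (n + i) * b k)"
    using sum.shift_bounds_nat_ivl[of _ 0 n N] by (simp add: add.commute lessThan_atLeast0)
  also have "\<dots> = (\<Sum>i<N. \<Sum>j<N.
      (if i \<le> j then Jac (n + i) (n - N + j) else 0) * q (n + i) * b (n - N + j))"
  proof (rule sum.cong[OF refl])
    fix i
    \<comment> \<open>Entries to the left of the band vanish: this restricts \<open>k\<close> to
      \<open>n - N \<le> k\<close>, and later removes the pairs with \<open>j < i\<close>.\<close>
    have lower: "Jac (n + i) k = 0" if "k + N < n + i" for k
      by (rule Jac_lower) (use that N_def in simp)
    have "(\<Sum>k<n. Jac (n + i) k * q (n + i) * b k) = (\<Sum>k=n-N..<n. Jac (n + i) k * q (n + i) * b k)"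
      by (rule sum.mono_neutral_right) (use lower in auto)
    also have "\<dots> = (\<Sum>j<N. Jac (n + i) (n - N + j) * q (n + i) * b (n - N + j))"
      using sum.shift_bounds_nat_ivl[of "\<lambda>k. Jac (n + i) k * q (n + i) * b k" 0 "n - N" N] n
      by (simp add: add.commute lessThan_atLeast0)
    also have "\<dots> = (\<Sum>j<N.
        (if i \<le> j then Jac (n + i) (n - N + j) else 0) * q (n + i) * b (n - N + j))"
      using n lower by (intro sum.cong) auto
    finally show "(\<Sum>k<n. Jac (n + i) k * q (n + i) * b k) =
      (\<Sum>j<N. (if i \<le> j then Jac (n + i) (n - N + j) else 0) * q (n + i) * b (n - N + j))" .
  qed
  finally have "q (n - 1) = (\<Sum>i<N. \<Sum>j<N.
      (if i \<le> j then Jac (n + i) (n - N + j) else 0) * q (n + i) * b (n - N + j)) / b n"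
    using nz by (simp add: b_def eq_divide_eq)
  also have "\<dots> = (\<Sum>i<N. q (n + i) *
      (\<Sum>j<N. (if i \<le> j then Jac (n + i) (n - N + j) else 0) * (b (n - N + j) / b n)))"
    by (simp add: sum_divide_distrib sum_distrib_left mult_ac)
  also have "\<dots> = scalar_prod (Matrix.vec N (\<lambda>i. Q (n + i) lam))
      (rec_matrix N (jacobi_matrix B) n *\<^sub>v ratio_vec N B lam n)"
    unfolding J
    by (simp add: scalar_prod_def rec_matrix_def ratio_vec_def lessThan_atLeast0 q_def b_def)
  finally show ?thesis by (simp add: q_def)
qed

end

section \<open>The recurrence, its characteristic polynomial and the multiplicity of
  \<open>1 / r_II\<close>\<close>

theorem theorem4:
  fixes \<Delta> :: "real set" and \<sigma> :: real and M :: "real measure"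
    and p :: nat and nv :: "nat \<Rightarrow> nat" and w :: "nat \<Rightarrow> real \<Rightarrow> real"
    and I :: "(real \<Rightarrow> real) \<Rightarrow> real" and \<xi> :: "nat \<Rightarrow> real \<Rightarrow> real"
    and B :: "nat \<Rightarrow> real poly" and Q :: "nat \<Rightarrow> real \<Rightarrow> real"
    and J :: "nat \<Rightarrow> nat \<Rightarrow> real" and N :: nat
    and lam :: real and c :: "nat \<Rightarrow> real" and r_II :: real and r :: "nat \<Rightarrow> complex"
    and \<phi> \<phi>_star \<Phi>_star :: "real poly" and \<alpha> :: "nat \<Rightarrow> nat \<Rightarrow> real"
  assumes setting: "mop_setting \<Delta> \<sigma> M p nv w"
    and I_eq: "I = signed_integral \<Delta> \<sigma> M"
    and xi_eq: "\<xi> = xi p nv w"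
    and B_eq: "B = type_II_poly I \<xi>"
    and Q_eq: "Q = type_I_form I \<xi>"
    and J_eq: "J = jacobi_matrix B"
    and N_eq: "N = band_width p nv"
    and J_lim: "\<And>j. j \<le> N \<Longrightarrow> (\<lambda>n. J (n + j) n) \<longlonglongrightarrow> c j"
    and c_N: "c N \<noteq> 0"
    and phi_eq: "\<phi> = phi N c lam"
    and phi_star_eq: "\<phi>_star = phi_star N c lam"
    and ratio: "(\<lambda>n. poly (B (n + 1)) lam / poly (B n) lam) \<longlonglongrightarrow> r_II"
    and r_II_root: "poly \<phi> r_II = 0"
    and roots: "proots (map_poly complex_of_real \<phi>) =
                  add_mset (complex_of_real r_II) (image_mset r (mset_set {1..N}))"
    and alpha_eq: "\<alpha> = rec_coeff N J B lam"
    and Phi_star_eq: "\<Phi>_star = recurrence_char_poly N \<alpha>"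
  shows "(\<forall>n\<ge>N. poly (B n) lam \<noteq> 0 \<longrightarrow>
            scalar_prod (Matrix.vec N (\<lambda>i. Q (n + i) lam))
              (rec_matrix N J n *\<^sub>v ratio_vec N B lam n) = Q (n - 1) lam)
       \<and> (\<forall>n\<ge>N. poly (B n) lam \<noteq> 0 \<longrightarrow> (\<Sum>i\<le>N. \<alpha> n i * Q (n - 1 + i) lam) = 0)
       \<and> (\<forall>i\<le>N. convergent (\<lambda>n. \<alpha> n i))
       \<and> [:1, - r_II:] dvd \<phi>_star
       \<and> \<Phi>_star = - (\<phi>_star div [:1, - r_II:])
       \<and> map_poly complex_of_real \<Phi>_star = - (\<Prod>i=1..N. [:1, - r i:])
       \<and> (Polynomial.order r_II \<phi> = 1 \<longrightarrow> poly \<Phi>_star (1 / r_II) \<noteq> 0)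
       \<and> (\<forall>m>1. Polynomial.order r_II \<phi> = m \<longrightarrow>
            poly \<Phi>_star (1 / r_II) = 0 \<and> Polynomial.order (1 / r_II) \<Phi>_star = m - 1)"
proof -
  have recur: "scalar_prod (Matrix.vec N (\<lambda>i. Q (n + i) lam))
      (rec_matrix N J n *\<^sub>v ratio_vec N B lam n) = Q (n - 1) lam"
    if "N \<le> n" "poly (B n) lam \<noteq> 0" for n
    using typeI_recurrence[OF setting, of n lam] that
    unfolding I_eq xi_eq B_eq Q_eq J_eq N_eq by blast
  have sum_form: "(\<Sum>i\<le>N. \<alpha> n i * Q (n - 1 + i) lam) = 0"
    if n: "N \<le> n" "poly (B n) lam \<noteq> 0" for n
  proof -
    have "1 \<le> N"
      using step_line.band_width_pos[OF step_line_setting[OF setting]] by (simp add: N_eq)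
    then have idx: "n - 1 + Suc i = n + i" for i
      using n by simp
    let ?v = "rec_matrix N J n *\<^sub>v ratio_vec N B lam n"
    have "(\<Sum>i\<le>N. \<alpha> n i * Q (n - 1 + i) lam) =
        \<alpha> n 0 * Q (n - 1 + 0) lam + (\<Sum>i<N. \<alpha> n (Suc i) * Q (n - 1 + Suc i) lam)"
      by (simp only: sum.atMost_shift)
    also have "\<dots> = - Q (n - 1) lam + (\<Sum>i<N. Q (n + i) lam * vec_index ?v i)"
      unfolding idx by (simp add: alpha_eq rec_coeff_def mult.commute)
    also have "(\<Sum>i<N. Q (n + i) lam * vec_index ?v i) =
        scalar_prod (Matrix.vec N (\<lambda>i. Q (n + i) lam)) ?v"
      by (simp add: scalar_prod_def lessThan_atLeast0 rec_matrix_def)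
    finally show ?thesis
      using recur[OF n] by simp
  qed
  \<comment> \<open>The constant term of \<open>\<phi>\<close> is \<open>c N\<close> because
    \<open>N \<ge> 1\<close>, so \<open>c_N\<close> excludes the root \<open>0\<close>.\<close>
  have r_nz: "r_II \<noteq> 0"
  proof
    assume "r_II = 0"
    then have "Polynomial.coeff \<phi> 0 = 0"
      using r_II_root by (simp add: poly_0_coeff_0)
    moreover have "Polynomial.coeff \<phi> 0 = Polynomial.coeff \<phi>_star (N + 1)"
      by (simp add: phi_eq phi_star_eq phi_star_def coeff_reflect_poly degree_phi)
    moreover have "1 \<le> N"
      using step_line.band_width_pos[OF step_line_setting[OF setting]] by (simp add: N_eq)
    ultimately show False
      using c_N by (simp add: phi_star_eq coeff_phi_star)
  qed
  have conv: "convergent (\<lambda>n. \<alpha> n i)" if "i \<le> N" for i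
    unfolding alpha_eq
    by (rule convergentI, rule rec_coeff_limit) (use J_lim ratio r_nz that in auto)
  have factor: "\<phi>_star = [:1, - r_II:] * - \<Phi>_star"
    unfolding phi_star_eq Phi_star_eq alpha_eq
    by (rule char_poly_factorization) (use J_lim ratio r_nz r_II_root phi_eq in auto)
  have reflect: "reflect_poly \<phi> = [:1, - r_II:] * - \<Phi>_star"
    using factor by (simp only: phi_star_eq phi_star_def phi_eq)
  \<comment> \<open>The leading coefficient of \<open>\<phi>\<close> is the constant term of its
    reflection.\<close>
  have monic: "lead_coeff \<phi> = 1"
    using coeff_phi_star[of N c lam 0] by (simp add: phi_star_def phi_eq)
  then have phi_nz: "\<phi> \<noteq> 0" by auto
  have "\<phi>_star div [:1, - r_II:] = - \<Phi>_star"
    unfolding factor by (rule nonzero_mult_div_cancel_left) simp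
  then have quotient: "\<Phi>_star = - (\<phi>_star div [:1, - r_II:])" by simp
  have order: "Polynomial.order r_II \<phi> = Suc (Polynomial.order (1 / r_II) \<Phi>_star)"
    by (rule order_factor[OF r_nz phi_nz reflect])
  \<comment> \<open>Excludes the zero polynomial in \<open>order_root\<close>, so that vanishing at
    \<open>1 / r_II\<close> means positive order.\<close>
  have "\<Phi>_star \<noteq> 0"
    using reflect phi_nz by auto
  then have order_0: "poly \<Phi>_star (1 / r_II) = 0 \<longleftrightarrow> Polynomial.order (1 / r_II) \<Phi>_star \<noteq> 0"
    by (simp add: order_root)
  show ?thesis
  proof (intro conjI allI impI)
    show "[:1, - r_II:] dvd \<phi>_star"
      by (rule dvdI[OF factor])
    show "map_poly complex_of_real \<Phi>_star = - (\<Prod>i=1..N. [:1, - r i:])"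
      by (rule reflected_roots_product[OF roots monic reflect])
  qed (use recur sum_form conv quotient order order_0 in auto)
qed

end
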